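(* There is an absolute constant $C>0$ such that the following holds for every integer $n\ge2$ and every $\varepsilon\in(0,1)$ (possibly depending on $n$). Let $\mathcal{G}$ be a family of graphs on a fixed labeled vertex set $V$ of size $n$ that is invariant under the action of $\mathfrak{S}_n$ by relabeling the vertices, and suppose $\mu(\mathcal{G})\ge\varepsilon$. For $T\ge0$ let $$\mathcal{G}_T=\{H:\min_{G\in\mathcal{G}}d(G,H)\le T\}.$$ Then $$\mu\big(\mathcal{G}_{C\log(1/\varepsilon)\sqrt{n/\log n}}\big)\ge 1-\varepsilon.$$
   Context: $\mu$ is the uniform probability measure on labeled graphs on the vertex set $V$, $|V|=n$ (equivalently, $\mu(\mathcal{S})=\mathbb{P}_{G\sim\mathbb{G}(n,1/2)}[G\in\mathcal{S}]$). For two graphs $G,H$ on $V$, $d(G,H)=\Delta(G\triangle H)$, where $G\triangle H$ is the graph on $V$ whose edge set is the symmetric difference of $E(G)$ and $E(H)$ and $\Delta$ denotes maximum degree. Logarithms are natural. *)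

theory Defs
  imports "HOL-Probability.Probability" "HOL-Combinatorics.Permutations"
begin

(* A simple graph on a fixed vertex set V is represented by its edge set,
   a set of two-element subsets of V. *)
type_synonym 'a graph = "'a set set"

definition all_edges :: "'a set \<Rightarrow> 'a set set" where
  "all_edges V = {e. e \<subseteq> V \<and> card e = 2}"

definition graphs_on :: "'a set \<Rightarrow> 'a graph set" where
  "graphs_on V = Pow (all_edges V)"

definition degree :: "'a graph \<Rightarrow> 'a \<Rightarrow> nat" where
  "degree E v = card {e \<in> E. v \<in> e}"

(* Only meaningful for finite nonempty V. *)
definition max_degree :: "'a set \<Rightarrow> 'a graph \<Rightarrow> nat" where
  "max_degree V E = Max (degree E ` V)"

definition graph_dist :: "'a set \<Rightarrow> 'a graph \<Rightarrow> 'a graph \<Rightarrow> nat" where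
  "graph_dist V G H = max_degree V (sym_diff G H)"

definition graph_measure :: "'a set \<Rightarrow> 'a graph set \<Rightarrow> real" where
  "graph_measure V \<S> = measure_pmf.prob (pmf_of_set (graphs_on V)) \<S>"

definition relabel :: "('a \<Rightarrow> 'a) \<Rightarrow> 'a graph \<Rightarrow> 'a graph" where
  "relabel \<pi> E = (\<lambda>e. \<pi> ` e) ` E"

definition relabel_invariant :: "'a set \<Rightarrow> 'a graph set \<Rightarrow> bool" where
  "relabel_invariant V \<G> \<longleftrightarrow> (\<forall>\<pi>. \<pi> permutes V \<longrightarrow> (\<forall>G\<in>\<G>. relabel \<pi> G \<in> \<G>))"

(* Min of the empty set is unspecified; the guard encodes the convention that the
   minimum over an empty family is infinite. *)
definition enlargement :: "'a set \<Rightarrow> 'a graph set \<Rightarrow> real \<Rightarrow> 'a graph set" where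
  "enlargement V \<G> T =
    {H \<in> graphs_on V. \<G> \<noteq> {} \<and> real (Min ((\<lambda>G. graph_dist V G H) ` \<G>)) \<le> T}"

end

theory Submission
  imports Defs
begin

text \<open>
Let s be \<open>sqrt (n / ln n)\<close>.  It is enough that for every relabeling-invariant family A the enlargement of
A by 12 s has at least three times the odds of A (lemma \<open>expansion_step\<close>).  Then about \<open>2 ln (1 / \<epsilon>)\<close>
steps lead from odds \<open>\<epsilon>\<close> to odds \<open>1 / \<epsilon>\<close> (lemma \<open>iterated_expansion\<close>).

The expansion step is a variance estimate for a truncated distance to A.  The distance used is built
from a smooth majorant of the maximum degree, the log-sum-exp of the degrees.  Its gradient at an edge
uv is at most twice the sum of the weights of u and v, where the weights form a probability
distribution on the vertices.  Hence the effects of flipping single edges have total O(n), although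
there are about \<open>n\<^sup>2 / 2\<close> edges (lemma \<open>soft_max_degree_total_increase\<close>).  The Efron-Stein inequality
would give a variance O(n) and fluctuations of order \<open>sqrt n\<close>.

The symmetry provides the logarithm.  As A is invariant, all edges have the same influence, which is
therefore only O(1/n) in L1, while the total squared L2 influence is O(n).  In this situation
Talagrand's L1-L2 inequality divides the variance bound by \<open>ln n\<close> (lemma \<open>level_variance\<close>).  The
inequality is derived from the logarithmic Sobolev inequality on the cube by a martingale argument
(theorem \<open>cube_L1_L2_inequality\<close>).

With the right truncation, flips affect the function only on the shell between A and its enlargement,
so the variance bound is proportional to the mass d of the shell.  The function differs by a multiple
of s on A and on the complement of the enlargement; with x and y the masses of these two sets, the
variance is at least a constant times \<open>x y s\<^sup>2\<close>.  Together, \<open>2 x y \<le> d = 1 - x - y\<close>, which is the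
expansion of the odds.
\<close>

section \<open>Functions on the discrete cube\<close>

definition cube_avg :: "'a set \<Rightarrow> ('a set \<Rightarrow> real) \<Rightarrow> real" where
  "cube_avg E f = (\<Sum>S\<in>Pow E. f S) / 2 ^ card E"

text \<open>
Up to sign, the change of f when e is flipped.  This form takes the same value at S and at S with e
flipped, so it is a function on the cube without the coordinate e.
\<close>
definition cube_diff :: "'a \<Rightarrow> ('a set \<Rightarrow> real) \<Rightarrow> 'a set \<Rightarrow> real" where
  "cube_diff e f S = f (insert e S) - f (S - {e})"

definition cube_var :: "'a set \<Rightarrow> ('a set \<Rightarrow> real) \<Rightarrow> real" where
  "cube_var E f = cube_avg E (\<lambda>S. (f S)\<^sup>2) - (cube_avg E f)\<^sup>2"

definition cube_ent :: "'a set \<Rightarrow> ('a set \<Rightarrow> real) \<Rightarrow> real" where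
  "cube_ent E f = cube_avg E (\<lambda>S. f S * ln (f S)) - cube_avg E f * ln (cube_avg E f)"

lemma cube_avg_cong: "(\<And>S. S \<subseteq> E \<Longrightarrow> f S = g S) \<Longrightarrow> cube_avg E f = cube_avg E g"
  unfolding cube_avg_def by (auto intro!: arg_cong2 [of _ _ _ _ "(/)"] sum.cong)

lemma cube_avg_mono: "(\<And>S. S \<subseteq> E \<Longrightarrow> f S \<le> g S) \<Longrightarrow> cube_avg E f \<le> cube_avg E g"
  unfolding cube_avg_def by (auto intro!: divide_right_mono sum_mono)

lemma cube_avg_nonneg: "(\<And>S. S \<subseteq> E \<Longrightarrow> 0 \<le> f S) \<Longrightarrow> 0 \<le> cube_avg E f"
  unfolding cube_avg_def by (auto intro!: divide_nonneg_nonneg sum_nonneg)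

lemma cube_avg_add: "cube_avg E (\<lambda>S. f S + g S) = cube_avg E f + cube_avg E g"
  unfolding cube_avg_def by (simp add: sum.distrib add_divide_distrib)

lemma cube_avg_diff: "cube_avg E (\<lambda>S. f S - g S) = cube_avg E f - cube_avg E g"
  unfolding cube_avg_def by (simp add: sum_subtractf diff_divide_distrib)

lemma cube_avg_cmult: "cube_avg E (\<lambda>S. c * f S) = c * cube_avg E f"
  unfolding cube_avg_def by (simp add: sum_distrib_left)

lemma cube_avg_divide: "cube_avg E (\<lambda>S. f S / c) = cube_avg E f / c"
  unfolding cube_avg_def by (simp add: sum_divide_distrib [symmetric])

lemma cube_avg_const: "finite E \<Longrightarrow> cube_avg E (\<lambda>S. c) = c"
  unfolding cube_avg_def by (simp add: card_Pow)

lemma cube_avg_sum: "cube_avg E (\<lambda>S. \<Sum>i\<in>I. f i S) = (\<Sum>i\<in>I. cube_avg E (f i))"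
  unfolding cube_avg_def
  by (subst sum.swap) (simp add: sum_divide_distrib)

lemmas cube_avg_linear = cube_avg_add cube_avg_diff cube_avg_cmult cube_avg_divide

lemma cube_avg_eq_0D:
  assumes "finite E" "\<And>S. S \<subseteq> E \<Longrightarrow> 0 \<le> f S" "cube_avg E f = 0" "S \<subseteq> E"
  shows "f S = 0"
proof -
  have "(\<Sum>S\<in>Pow E. f S) = 0"
    using assms(3) by (simp add: cube_avg_def)
  then have "\<forall>S\<in>Pow E. f S = 0"
    using assms(1,2) by (subst (asm) sum_nonneg_eq_0_iff) auto
  with assms(4) show ?thesis by blast
qed

lemma cube_avg_insert:
  assumes "finite E" "a \<notin> E"
  shows "cube_avg (insert a E) f = (cube_avg E f + cube_avg E (\<lambda>S. f (insert a S))) / 2"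
proof -
  have disj: "Pow E \<inter> insert a ` Pow E = {}"
    using assms(2) by auto
  have inj: "inj_on (insert a) (Pow E)"
    using assms(2) by (auto simp: inj_on_def dest: insert_ident [THEN iffD1, rotated 2])
  have "(\<Sum>S\<in>Pow (insert a E). f S) = (\<Sum>S\<in>Pow E. f S) + (\<Sum>S\<in>Pow E. f (insert a S))"
    unfolding Pow_insert using assms(1) disj
    by (subst sum.union_disjoint) (auto simp: sum.reindex [OF inj])
  then show ?thesis
    using assms by (simp add: cube_avg_def field_simps)
qed

lemma cube_avg_reindex:
  assumes "bij_betw p (Pow E) (Pow E)"
  shows "cube_avg E (\<lambda>S. f (p S)) = cube_avg E f"
  unfolding cube_avg_def using sum.reindex_bij_betw [OF assms, of f] by simp

lemma cube_Cauchy_Schwarz: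
  "(cube_avg E (\<lambda>S. f S * g S))\<^sup>2 \<le> cube_avg E (\<lambda>S. (f S)\<^sup>2) * cube_avg E (\<lambda>S. (g S)\<^sup>2)"
  unfolding cube_avg_def
  using Cauchy_Schwarz_ineq_sum [of f g "Pow E"]
  by (simp add: power_divide power2_eq_square divide_right_mono)

section \<open>Entropy and the logarithmic Sobolev inequality\<close>

text \<open>
From \<open>ln u \<le> u - 1\<close>, the entropy of a nonnegative variable is at most its variance divided by its
mean.  For two equally likely values x and y this is \<open>((x - y) / 2)\<^sup>2 / m\<close> with m their mean, and
factoring \<open>x - y\<close> through square roots leaves \<open>(sqrt x + sqrt y)\<^sup>2 \<le> 4 m\<close>.  The optimal constant
would be one half; this simple argument loses a factor of two, which is harmless here.
\<close>
lemma two_point_entropy: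
  fixes x y :: real
  assumes "0 \<le> x" "0 \<le> y"
  shows "(x * ln x + y * ln y) / 2 - (x + y) / 2 * ln ((x + y) / 2) \<le> (sqrt x - sqrt y)\<^sup>2"
proof (cases "x + y = 0")
  case True
  with assms have "x = 0" "y = 0" by auto
  then show ?thesis by simp
next
  case False
  define m where "m = (x + y) / 2"
  have m: "m > 0" using False assms by (simp add: m_def)
  have *: "t * ln t - t * ln m \<le> t * (t / m - 1)" if "0 \<le> t" for t
  proof (cases "t = 0")
    case False
    with that have t: "t > 0" by simp
    have "ln t - ln m = ln (t / m)" using t m by (simp add: ln_div)
    also have "\<dots> \<le> t / m - 1" using t m by (intro ln_le_minus_one) simp
    finally show ?thesis
      using mult_left_mono [of "ln t - ln m" "t / m - 1" t] t by (simp add: algebra_simps)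
  qed simp
  have "(x * ln x + y * ln y) / 2 - m * ln m
      = ((x * ln x - x * ln m) + (y * ln y - y * ln m)) / 2"
    by (simp add: m_def field_simps)
  also have "\<dots> \<le> (x * (x / m - 1) + y * (y / m - 1)) / 2"
    using * [OF assms(1)] * [OF assms(2)] by (intro divide_right_mono add_mono) auto
  also have "\<dots> = ((x - y) / 2)\<^sup>2 / m"
  proof -
    have "(x * (x / m - 1) + y * (y / m - 1)) / 2 * m = (x\<^sup>2 + y\<^sup>2 - m * (x + y)) / 2"
      using m by (simp add: field_simps power2_eq_square)
    also have "\<dots> = ((x - y) / 2)\<^sup>2"
      by (simp add: m_def power2_eq_square field_simps)
    finally show ?thesis using m by (simp add: field_simps)
  qed
  also have "\<dots> \<le> (sqrt x - sqrt y)\<^sup>2"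
  proof -
    have sq: "(sqrt x)\<^sup>2 = x" "(sqrt y)\<^sup>2 = y" using assms by auto
    have "x - y = (sqrt x)\<^sup>2 - (sqrt y)\<^sup>2" using sq by simp
    also have "\<dots> = (sqrt x - sqrt y) * (sqrt x + sqrt y)"
      by (simp add: power2_eq_square algebra_simps)
    finally have "(x - y)\<^sup>2 = (sqrt x - sqrt y)\<^sup>2 * (sqrt x + sqrt y)\<^sup>2"
      by (simp add: power_mult_distrib)
    moreover have "(sqrt x + sqrt y)\<^sup>2 \<le> 4 * m"
    proof -
      have "4 * m - (sqrt x + sqrt y)\<^sup>2 = 2 * ((sqrt x)\<^sup>2 + (sqrt y)\<^sup>2) - (sqrt x + sqrt y)\<^sup>2"
        using sq by (simp add: m_def)
      also have "\<dots> = (sqrt x - sqrt y)\<^sup>2"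
        by (simp add: power2_eq_square algebra_simps)
      finally show ?thesis by (metis diff_ge_0_iff_ge zero_le_power2)
    qed
    ultimately have "(x - y)\<^sup>2 \<le> (sqrt x - sqrt y)\<^sup>2 * (4 * m)"
      by (simp add: mult_left_mono)
    then show ?thesis using m by (simp add: field_simps power_divide)
  qed
  finally show ?thesis by (simp add: m_def)
qed

lemma cube_L2_reverse_triangle:
  "(sqrt (cube_avg E (\<lambda>S. (f S)\<^sup>2)) - sqrt (cube_avg E (\<lambda>S. (g S)\<^sup>2)))\<^sup>2
     \<le> cube_avg E (\<lambda>S. (g S - f S)\<^sup>2)"
proof -
  define M N where "M = cube_avg E (\<lambda>S. (f S)\<^sup>2)" and "N = cube_avg E (\<lambda>S. (g S)\<^sup>2)"
  have nn: "M \<ge> 0" "N \<ge> 0" unfolding M_def N_def by (auto intro: cube_avg_nonneg)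
  have "cube_avg E (\<lambda>S. f S * g S) \<le> sqrt (M * N)"
    using cube_Cauchy_Schwarz [of E f g] by (simp add: M_def N_def real_le_rsqrt)
  moreover have "cube_avg E (\<lambda>S. (g S - f S)\<^sup>2) = M + N - 2 * cube_avg E (\<lambda>S. f S * g S)"
  proof -
    have "(\<lambda>S. (g S - f S)\<^sup>2) = (\<lambda>S. (f S)\<^sup>2 + (g S)\<^sup>2 - 2 * (f S * g S))"
      by (simp add: power2_eq_square algebra_simps)
    then show ?thesis unfolding M_def N_def by (simp only: cube_avg_linear)
  qed
  moreover have "(sqrt M - sqrt N)\<^sup>2 = M + N - 2 * sqrt (M * N)"
    using nn by (simp add: power2_diff real_sqrt_mult)
  ultimately show ?thesis by (simp add: M_def [symmetric] N_def [symmetric])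
qed

lemma cube_diff_insert:
  "e \<noteq> a \<Longrightarrow> cube_diff e f (insert a S) = cube_diff e (\<lambda>S. f (insert a S)) S"
  by (simp add: cube_diff_def insert_commute insert_Diff_if)

lemma cube_diff_same: "cube_diff a f (insert a S) = cube_diff a f S"
  by (simp add: cube_diff_def)

text \<open>
Splitting the cube along the coordinate a.  The function \<open>\<phi>\<close> will be the square or the absolute value.
\<close>
lemma cube_avg_diff_insert:
  assumes "finite E" "a \<notin> E"
  shows "e \<in> E \<Longrightarrow> cube_avg (insert a E) (\<lambda>S. \<phi> (cube_diff e f S)) =
      (cube_avg E (\<lambda>S. \<phi> (cube_diff e f S)) +
       cube_avg E (\<lambda>S. \<phi> (cube_diff e (\<lambda>S. f (insert a S)) S))) / 2"
    and "cube_avg (insert a E) (\<lambda>S. \<phi> (cube_diff a f S)) =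
      cube_avg E (\<lambda>S. \<phi> (f (insert a S) - f S))"
proof -
  show "cube_avg (insert a E) (\<lambda>S. \<phi> (cube_diff e f S)) =
      (cube_avg E (\<lambda>S. \<phi> (cube_diff e f S)) +
       cube_avg E (\<lambda>S. \<phi> (cube_diff e (\<lambda>S. f (insert a S)) S))) / 2" if "e \<in> E"
  proof -
    have "e \<noteq> a" using that assms by auto
    then show ?thesis
      using assms by (simp add: cube_avg_insert cube_diff_insert)
  qed
  have "cube_diff a f S = f (insert a S) - f S" if "S \<subseteq> E" for S
  proof -
    have "S - {a} = S" using that assms by blast
    then show ?thesis by (simp add: cube_diff_def)
  qed
  then show "cube_avg (insert a E) (\<lambda>S. \<phi> (cube_diff a f S)) =
      cube_avg E (\<lambda>S. \<phi> (f (insert a S) - f S))"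
    using assms by (simp add: cube_avg_insert cube_diff_same cong: cube_avg_cong)
qed

text \<open>
Entropy tensorizes.  Conditioning on the coordinate a splits the entropy of \<open>g\<^sup>2\<close> into the average
entropy of the two halves and the two-point entropy of their means.  The latter is bounded by the
squared difference of the two L2 norms, hence by the L2 norm of the difference, which is the
contribution of the direction a.
\<close>
theorem cube_log_Sobolev:
  assumes "finite E"
  shows "cube_ent E (\<lambda>S. (g S)\<^sup>2) \<le> (\<Sum>e\<in>E. cube_avg E (\<lambda>S. (cube_diff e g S)\<^sup>2))"
  using assms
proof (induction E arbitrary: g rule: finite_induct)
  case empty
  then show ?case by (simp add: cube_ent_def cube_avg_def)
next
  case (insert a E)
  define g1 where "g1 = (\<lambda>S. g (insert a S))"
  define N0 N1 where "N0 = cube_avg E (\<lambda>S. (g S)\<^sup>2)" and "N1 = cube_avg E (\<lambda>S. (g1 S)\<^sup>2)"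
  have nn: "N0 \<ge> 0" "N1 \<ge> 0" unfolding N0_def N1_def by (auto intro: cube_avg_nonneg)
  have "cube_ent (insert a E) (\<lambda>S. (g S)\<^sup>2)
      = (cube_ent E (\<lambda>S. (g S)\<^sup>2) + cube_ent E (\<lambda>S. (g1 S)\<^sup>2)) / 2
        + ((N0 * ln N0 + N1 * ln N1) / 2 - (N0 + N1) / 2 * ln ((N0 + N1) / 2))"
    using insert.hyps unfolding cube_ent_def N0_def N1_def g1_def
    by (simp add: cube_avg_insert field_simps)
  also have "\<dots> \<le> ((\<Sum>e\<in>E. cube_avg E (\<lambda>S. (cube_diff e g S)\<^sup>2))
         + (\<Sum>e\<in>E. cube_avg E (\<lambda>S. (cube_diff e g1 S)\<^sup>2))) / 2 + cube_avg E (\<lambda>S. (g1 S - g S)\<^sup>2)"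
    using insert.IH [of g] insert.IH [of g1] two_point_entropy [OF nn]
      cube_L2_reverse_triangle [of E g g1]
    unfolding N0_def N1_def by argo
  also have "\<dots> = (\<Sum>e\<in>insert a E. cube_avg (insert a E) (\<lambda>S. (cube_diff e g S)\<^sup>2))"
    using insert.hyps cube_avg_diff_insert(1) [OF insert.hyps, of _ "\<lambda>x. x\<^sup>2" g]
      cube_avg_diff_insert(2) [OF insert.hyps, of "\<lambda>x. x\<^sup>2" g]
    by (simp add: g1_def sum.distrib add_divide_distrib sum_divide_distrib)
  finally show ?case .
qed

text \<open>
A function whose L1 norm is much smaller than its L2 norm must be concentrated on a small set, so its
square has large entropy: at least \<open>M ln (M / m\<^sup>2)\<close>, where M is the mean of \<open>g\<^sup>2\<close> and m the mean of
\<open>\<bar>g\<bar>\<close>.  The logarithm is replaced by its tangents, indexed by l; in this linearized form the bounds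
for different functions can simply be added.
\<close>
lemma cube_ent_lower:
  assumes "finite E"
  shows "l * cube_avg E (\<lambda>S. (g S)\<^sup>2)
     \<le> cube_ent E (\<lambda>S. (g S)\<^sup>2) + exp (l - 1) * (cube_avg E (\<lambda>S. \<bar>g S\<bar>))\<^sup>2"
proof -
  define M m where "M = cube_avg E (\<lambda>S. (g S)\<^sup>2)" and "m = cube_avg E (\<lambda>S. \<bar>g S\<bar>)"
  have nn: "M \<ge> 0" "m \<ge> 0" unfolding M_def m_def by (auto intro: cube_avg_nonneg)
  show ?thesis
  proof (cases "m = 0")
    case True
    have "g S = 0" if "S \<subseteq> E" for S
      using cube_avg_eq_0D [OF assms _ True [unfolded m_def] that] by simp
    then have "cube_avg E (\<lambda>S. (g S)\<^sup>2) = 0" "cube_avg E (\<lambda>S. (g S)\<^sup>2 * ln ((g S)\<^sup>2)) = 0"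
      using assms by (simp_all add: cube_avg_const cong: cube_avg_cong)
    then show ?thesis by (simp add: cube_ent_def)
  next
    case False
    with nn have m: "m > 0" by simp
    have M: "M > 0"
    proof (rule ccontr)
      assume "\<not> M > 0"
      with nn have "M = 0" by simp
      then have "(g S)\<^sup>2 = 0" if "S \<subseteq> E" for S
        using cube_avg_eq_0D [of E "\<lambda>S. (g S)\<^sup>2" S] assms that by (simp add: M_def)
      then have "g S = 0" if "S \<subseteq> E" for S
        using that by simp
      then have "m = 0"
        using assms by (simp add: m_def cube_avg_const cong: cube_avg_cong)
      with m show False by simp
    qed
    \<comment> \<open>The value of s that optimizes the tangent bound on the logarithm in the next step.\<close>
    define s where "s = M / m"
    have s: "s > 0" using m M by (simp add: s_def)
    have pw: "2 * (ln s + 1) * (g S)\<^sup>2 - 2 * s * \<bar>g S\<bar> \<le> (g S)\<^sup>2 * ln ((g S)\<^sup>2)" for S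
    proof (cases "g S = 0")
      case False
      define t where "t = \<bar>g S\<bar>"
      have t: "t > 0" "(g S)\<^sup>2 = t\<^sup>2" using False by (auto simp: t_def)
      have "ln s - ln t = ln (s / t)" using s t by (simp add: ln_div)
      also have "\<dots> \<le> s / t - 1" using s t by (intro ln_le_minus_one) simp
      finally have "2 * t\<^sup>2 * (ln s + 1 - s / t) \<le> 2 * t\<^sup>2 * ln t"
        by (intro mult_left_mono) auto
      moreover have "2 * t\<^sup>2 * (ln s + 1 - s / t) = 2 * (ln s + 1) * t\<^sup>2 - 2 * s * t"
        using t(1) by (simp add: power2_eq_square field_simps)
      moreover have "ln (t\<^sup>2) = 2 * ln t" using t(1) by (simp add: ln_realpow)
      ultimately have "2 * (ln s + 1) * t\<^sup>2 - 2 * s * t \<le> t\<^sup>2 * ln (t\<^sup>2)"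
        by simp
      then show ?thesis by (simp only: t(2) t_def [symmetric])
    qed simp
    have "2 * (ln s + 1) * M - 2 * s * m \<le> cube_avg E (\<lambda>S. (g S)\<^sup>2 * ln ((g S)\<^sup>2))"
      using cube_avg_mono [OF pw] unfolding M_def m_def by (simp add: cube_avg_linear)
    then have "2 * M * ln s - M * ln M \<le> cube_ent E (\<lambda>S. (g S)\<^sup>2)"
      using m by (simp add: cube_ent_def M_def [symmetric] s_def algebra_simps)
    moreover have "ln s = ln M - ln m" using m M by (simp add: s_def ln_div)
    ultimately have ent: "M * (ln M - 2 * ln m) \<le> cube_ent E (\<lambda>S. (g S)\<^sup>2)"
      by (simp add: algebra_simps)
    \<comment> \<open>The tangent to \<open>M \<mapsto> M ln (M / m\<^sup>2)\<close> with slope l touches the graph at \<open>M = y\<close>.\<close>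
    define y where "y = exp (l - 1) * m\<^sup>2"
    have y: "y > 0" using m by (simp add: y_def)
    have "ln y - ln M = ln (y / M)" using y M by (simp add: ln_div)
    also have "\<dots> \<le> y / M - 1" using y M by (intro ln_le_minus_one) simp
    finally have "M * (ln y - ln M) \<le> y - M"
      using M by (simp add: field_simps)
    moreover have "ln y = l - 1 + 2 * ln m"
      using m by (simp add: y_def ln_mult ln_realpow)
    ultimately have "M * l \<le> M * (ln M - 2 * ln m) + y"
      by (simp add: algebra_simps)
    with ent show ?thesis
      unfolding M_def [symmetric] m_def [symmetric] y_def by (simp add: mult.commute)
  qed
qed

section \<open>Variance and influences\<close>

text \<open>
A form of Talagrand's L1-L2 inequality, following Falik and Samorodnitsky: the variance is the sum of
the second moments of martingale differences.  Averaging over the coordinate a peels off one such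
difference, half of g below.  Up to an L1 term, l times its second moment is bounded by the entropy of
its square, hence by its discrete energy; and that energy is exactly what the averaging takes away from
the energy of f in the other directions.  The usual inequality follows by optimizing over l, but a fixed l is more
convenient when the L1 norms are only known up to upper bounds.
\<close>
theorem cube_L1_L2_inequality:
  assumes "finite E"
  shows "l * cube_var E f \<le> (\<Sum>e\<in>E. cube_avg E (\<lambda>S. (cube_diff e f S)\<^sup>2)
      + exp (l - 1) / 4 * (cube_avg E (\<lambda>S. \<bar>cube_diff e f S\<bar>))\<^sup>2)"
  using assms
proof (induction E arbitrary: f rule: finite_induct)
  case empty
  then show ?case by (simp add: cube_var_def cube_avg_def)
next
  case (insert a E)
  define k where "k = exp (l - 1) / 4"
  have k: "k \<ge> 0" by (simp add: k_def)
  define f1 where "f1 = (\<lambda>S. f (insert a S))"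
  define u where "u = (\<lambda>S. (f S + f1 S) / 2)"
  define g where "g = (\<lambda>S. f1 S - f S)"
  have var: "cube_var (insert a E) f = cube_var E u + cube_avg E (\<lambda>S. (g S)\<^sup>2) / 4"
  proof -
    have "cube_avg (insert a E) (\<lambda>S. (f S)\<^sup>2) = cube_avg E (\<lambda>S. ((f S)\<^sup>2 + (f1 S)\<^sup>2) / 2)"
      using insert.hyps by (simp add: cube_avg_insert cube_avg_linear f1_def)
    also have "\<dots> = cube_avg E (\<lambda>S. (u S)\<^sup>2 + (g S)\<^sup>2 / 4)"
      by (rule cube_avg_cong) (simp add: u_def g_def power2_eq_square field_simps)
    finally show ?thesis
      using insert.hyps unfolding cube_var_def
      by (simp add: cube_avg_insert cube_avg_linear f1_def u_def)
  qed
  have lin: "cube_diff e u S = (cube_diff e f S + cube_diff e f1 S) / 2"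
       "cube_diff e g S = cube_diff e f1 S - cube_diff e f S" for e S
    by (auto simp: cube_diff_def u_def g_def field_simps)
  have sq: "cube_avg (insert a E) (\<lambda>S. (cube_diff e f S)\<^sup>2)
      = cube_avg E (\<lambda>S. (cube_diff e u S)\<^sup>2) + cube_avg E (\<lambda>S. (cube_diff e g S)\<^sup>2) / 4"
    if "e \<in> E" for e
  proof -
    have "cube_avg (insert a E) (\<lambda>S. (cube_diff e f S)\<^sup>2)
        = cube_avg E (\<lambda>S. ((cube_diff e f S)\<^sup>2 + (cube_diff e f1 S)\<^sup>2) / 2)"
      using cube_avg_diff_insert(1) [OF insert.hyps that, of "\<lambda>x. x\<^sup>2" f]
      by (simp add: cube_avg_linear f1_def)
    also have "\<dots> = cube_avg E (\<lambda>S. (cube_diff e u S)\<^sup>2 + (cube_diff e g S)\<^sup>2 / 4)"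
      by (rule cube_avg_cong) (simp add: lin power2_eq_square field_simps)
    finally show ?thesis by (simp add: cube_avg_linear)
  qed
  have ab: "(cube_avg E (\<lambda>S. \<bar>cube_diff e u S\<bar>))\<^sup>2
      \<le> (cube_avg (insert a E) (\<lambda>S. \<bar>cube_diff e f S\<bar>))\<^sup>2" if "e \<in> E" for e
  proof (rule power_mono)
    have "cube_avg E (\<lambda>S. \<bar>cube_diff e u S\<bar>)
        \<le> cube_avg E (\<lambda>S. (\<bar>cube_diff e f S\<bar> + \<bar>cube_diff e f1 S\<bar>) / 2)"
      by (rule cube_avg_mono) (simp add: lin)
    also have "\<dots> = cube_avg (insert a E) (\<lambda>S. \<bar>cube_diff e f S\<bar>)"
      using cube_avg_diff_insert(1) [OF insert.hyps that, of abs f]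
      by (simp add: cube_avg_linear f1_def)
    finally show "cube_avg E (\<lambda>S. \<bar>cube_diff e u S\<bar>)
        \<le> cube_avg (insert a E) (\<lambda>S. \<bar>cube_diff e f S\<bar>)" .
  qed (auto intro: cube_avg_nonneg)
  have da: "cube_avg (insert a E) (\<lambda>S. (cube_diff a f S)\<^sup>2) = cube_avg E (\<lambda>S. (g S)\<^sup>2)"
     "cube_avg (insert a E) (\<lambda>S. \<bar>cube_diff a f S\<bar>) = cube_avg E (\<lambda>S. \<bar>g S\<bar>)"
    using cube_avg_diff_insert(2) [OF insert.hyps, of "\<lambda>x. x\<^sup>2" f]
      cube_avg_diff_insert(2) [OF insert.hyps, of abs f]
    by (simp_all add: g_def f1_def)
  have "l * cube_avg E (\<lambda>S. (g S)\<^sup>2)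
      \<le> (\<Sum>e\<in>E. cube_avg E (\<lambda>S. (cube_diff e g S)\<^sup>2)) + 4 * k * (cube_avg E (\<lambda>S. \<bar>g S\<bar>))\<^sup>2"
    using cube_ent_lower [OF insert.hyps(1), of l g] cube_log_Sobolev [OF insert.hyps(1), of g]
    by (simp add: k_def)
  then have G: "l * (cube_avg E (\<lambda>S. (g S)\<^sup>2) / 4)
      \<le> (\<Sum>e\<in>E. cube_avg E (\<lambda>S. (cube_diff e g S)\<^sup>2) / 4) + k * (cube_avg E (\<lambda>S. \<bar>g S\<bar>))\<^sup>2"
    by (simp add: sum_divide_distrib [symmetric])
  have "l * cube_var (insert a E) f = l * cube_var E u + l * (cube_avg E (\<lambda>S. (g S)\<^sup>2) / 4)"
    by (simp add: var algebra_simps)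
  also have "\<dots> \<le> (\<Sum>e\<in>E. cube_avg E (\<lambda>S. (cube_diff e u S)\<^sup>2)
        + k * (cube_avg E (\<lambda>S. \<bar>cube_diff e u S\<bar>))\<^sup>2)
      + ((\<Sum>e\<in>E. cube_avg E (\<lambda>S. (cube_diff e g S)\<^sup>2) / 4) + k * (cube_avg E (\<lambda>S. \<bar>g S\<bar>))\<^sup>2)"
    using insert.IH [of u] G unfolding k_def by (rule add_mono)
  also have "\<dots> = (\<Sum>e\<in>E. cube_avg (insert a E) (\<lambda>S. (cube_diff e f S)\<^sup>2)
        + k * (cube_avg E (\<lambda>S. \<bar>cube_diff e u S\<bar>))\<^sup>2) + k * (cube_avg E (\<lambda>S. \<bar>g S\<bar>))\<^sup>2"
    by (simp add: sq sum.distrib)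
  also have "\<dots> \<le> (\<Sum>e\<in>E. cube_avg (insert a E) (\<lambda>S. (cube_diff e f S)\<^sup>2)
        + k * (cube_avg (insert a E) (\<lambda>S. \<bar>cube_diff e f S\<bar>))\<^sup>2)
      + (cube_avg E (\<lambda>S. (g S)\<^sup>2) + k * (cube_avg E (\<lambda>S. \<bar>g S\<bar>))\<^sup>2)"
    using k by (intro add_mono sum_mono mult_left_mono ab order_refl)
      (auto intro: cube_avg_nonneg)
  also have "\<dots> = (\<Sum>e\<in>insert a E. cube_avg (insert a E) (\<lambda>S. (cube_diff e f S)\<^sup>2)
        + k * (cube_avg (insert a E) (\<lambda>S. \<bar>cube_diff e f S\<bar>))\<^sup>2)"
    using insert.hyps by (simp add: da)
  finally show ?case by (simp add: k_def)
qed

lemma cube_avg_flip: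
  assumes "finite E" "e \<in> E"
  shows "cube_avg E (\<lambda>S. f (sym_diff S {e})) = cube_avg E f"
proof (rule cube_avg_reindex)
  show "bij_betw (\<lambda>S. sym_diff S {e}) (Pow E) (Pow E)"
    using assms(2)
    by (intro bij_betw_byWitness [where f' = "\<lambda>S. sym_diff S {e}"]) auto
qed

lemma abs_cube_diff: "\<bar>cube_diff e f S\<bar> = \<bar>f (sym_diff S {e}) - f S\<bar>"
proof (cases "e \<in> S")
  case True
  then have "sym_diff S {e} = S - {e}" "insert e S = S" by auto
  then show ?thesis by (simp add: cube_diff_def)
next
  case False
  then have "sym_diff S {e} = insert e S" "S - {e} = S" by auto
  then show ?thesis by (simp add: cube_diff_def)
qed

text \<open>
Flipping a coordinate preserves the uniform measure and exchanges increase with decrease.  Hence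
bounds on increases alone control the absolute differences; this matters because a minimum of
functions inherits only one-sided bounds from the minimizer.
\<close>
lemma cube_avg_abs_diff:
  assumes "finite E" "e \<in> E"
  shows "cube_avg E (\<lambda>S. \<bar>cube_diff e f S\<bar>)
       = 2 * cube_avg E (\<lambda>S. max 0 (f (sym_diff S {e}) - f S))"
proof -
  define inc where "inc = (\<lambda>S. max 0 (f (sym_diff S {e}) - f S))"
  have flip: "sym_diff (sym_diff S {e}) {e} = S" for S by auto
  have "\<bar>cube_diff e f S\<bar> = inc S + inc (sym_diff S {e})" for S
    unfolding abs_cube_diff inc_def flip by linarith
  then have "cube_avg E (\<lambda>S. \<bar>cube_diff e f S\<bar>) = cube_avg E (\<lambda>S. inc S + inc (sym_diff S {e}))"
    by presburger
  then show ?thesis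
    unfolding cube_avg_add cube_avg_flip [OF assms] by (simp add: inc_def)
qed

lemma influence_automorphism:
  assumes p: "bij_betw p E E" and e: "e \<in> E"
    and inv: "\<And>S. S \<subseteq> E \<Longrightarrow> f (p ` S) = f S"
  shows "cube_avg E (\<lambda>S. \<bar>cube_diff (p e) f S\<bar>) = cube_avg E (\<lambda>S. \<bar>cube_diff e f S\<bar>)"
proof -
  have "cube_diff (p e) f (p ` S) = cube_diff e f S" if S: "S \<subseteq> E" for S
  proof -
    have "p ` S - {p e} = p ` (S - {e})"
      using p S e by (auto simp: bij_betw_def inj_on_def)
    moreover have "insert (p e) (p ` S) = p ` insert e S" by simp
    moreover have "insert e S \<subseteq> E" "S - {e} \<subseteq> E" using S e by auto
    ultimately show ?thesis
      using inv by (simp only: cube_diff_def)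
  qed
  then have "cube_avg E (\<lambda>S. \<bar>cube_diff e f S\<bar>)
      = cube_avg E (\<lambda>S. \<bar>cube_diff (p e) f (p ` S)\<bar>)"
    by (intro cube_avg_cong) simp
  also have "\<dots> = cube_avg E (\<lambda>S. \<bar>cube_diff (p e) f S\<bar>)"
    by (rule cube_avg_reindex [OF bij_betw_Pow [OF p]])
  finally show ?thesis by simp
qed

text \<open>
When all N influences agree and their total is at most B, each is at most \<open>B / N\<close>, so the sum of their
squares is at most \<open>B\<^sup>2 / N\<close>.  Here the differences are bounded by 1, so the energy is at most B too.
\<close>
lemma variance_bound_equal_influences:
  assumes E: "finite E" "E \<noteq> {}"
    and lip: "\<And>e S. e \<in> E \<Longrightarrow> S \<subseteq> E \<Longrightarrow> \<bar>cube_diff e f S\<bar> \<le> 1"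
    and equal: "\<And>e e'. e \<in> E \<Longrightarrow> e' \<in> E \<Longrightarrow>
      cube_avg E (\<lambda>S. \<bar>cube_diff e f S\<bar>) = cube_avg E (\<lambda>S. \<bar>cube_diff e' f S\<bar>)"
    and total: "(\<Sum>e\<in>E. cube_avg E (\<lambda>S. \<bar>cube_diff e f S\<bar>)) \<le> B"
  shows "l * cube_var E f \<le> B + exp (l - 1) / 4 * (B\<^sup>2 / card E)"
proof -
  obtain a where a: "a \<in> E" using E by auto
  define J where "J = cube_avg E (\<lambda>S. \<bar>cube_diff a f S\<bar>)"
  have J: "cube_avg E (\<lambda>S. \<bar>cube_diff e f S\<bar>) = J" if "e \<in> E" for e
    unfolding J_def by (rule equal [OF that a])
  have J0: "J \<ge> 0" unfolding J_def by (rule cube_avg_nonneg) simp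
  have N: "real (card E) > 0" using E by (simp add: card_gt_0_iff)
  have B: "card E * J \<le> B" using total J by simp
  have sq: "cube_avg E (\<lambda>S. (cube_diff e f S)\<^sup>2) \<le> J" if "e \<in> E" for e
    unfolding J [OF that, symmetric]
  proof (rule cube_avg_mono)
    fix S assume "S \<subseteq> E"
    then have "\<bar>cube_diff e f S\<bar> * \<bar>cube_diff e f S\<bar> \<le> \<bar>cube_diff e f S\<bar> * 1"
      using lip that by (intro mult_left_mono) auto
    then show "(cube_diff e f S)\<^sup>2 \<le> \<bar>cube_diff e f S\<bar>"
      by (simp add: power2_eq_square)
  qed
  have "l * cube_var E f \<le> (\<Sum>e\<in>E. J + exp (l - 1) / 4 * J\<^sup>2)"
    using cube_L1_L2_inequality [OF E(1), of l f]
  proof (rule order_trans, intro sum_mono)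
    fix e assume "e \<in> E"
    then show "cube_avg E (\<lambda>S. (cube_diff e f S)\<^sup>2)
        + exp (l - 1) / 4 * (cube_avg E (\<lambda>S. \<bar>cube_diff e f S\<bar>))\<^sup>2 \<le> J + exp (l - 1) / 4 * J\<^sup>2"
      using sq [of e] by (simp add: J)
  qed
  also have "\<dots> = card E * J + exp (l - 1) / 4 * ((card E * J)\<^sup>2 / card E)"
    using N by (simp add: power2_eq_square field_simps)
  also have "\<dots> \<le> B + exp (l - 1) / 4 * (B\<^sup>2 / card E)"
    using B J0 N by (intro add_mono mult_left_mono divide_right_mono power_mono) auto
  finally show ?thesis .
qed

text \<open>
If the mean m lies between a and b, the variance is at least \<open>x r\<^sup>2 + y s\<^sup>2\<close>, where x and y are the
masses of P and Q, \<open>r = m - a\<close> and \<open>s = b - m\<close>.  Truncation of r and s at 0 covers the other positions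
of m.  The Cauchy-Schwarz inequality then removes m.
\<close>
lemma variance_lower_bound_two_sets:
  assumes E: "finite E" and disj: "P \<inter> Q = {}" and ab: "a \<le> b"
    and P: "\<And>S. S \<subseteq> E \<Longrightarrow> S \<in> P \<Longrightarrow> f S \<le> a"
    and Q: "\<And>S. S \<subseteq> E \<Longrightarrow> S \<in> Q \<Longrightarrow> b \<le> f S"
  shows "cube_avg E (indicator P) * cube_avg E (indicator Q) * (b - a)\<^sup>2 \<le> cube_var E f"
proof -
  define m where "m = cube_avg E f"
  define x y where "x = cube_avg E (indicator P)" and "y = cube_avg E (indicator Q)"
  define r s where "r = max 0 (m - a)" and "s = max 0 (b - m)"
  have nn: "x \<ge> 0" "y \<ge> 0" unfolding x_def y_def by (auto intro: cube_avg_nonneg)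
  have "x + y = cube_avg E (\<lambda>S. indicator P S + indicator Q S)"
    by (simp add: x_def y_def cube_avg_add)
  also have "\<dots> \<le> cube_avg E (\<lambda>S. 1)"
    using disj by (intro cube_avg_mono) (auto simp: indicator_def)
  finally have xy: "x + y \<le> 1" using E by (simp add: cube_avg_const)
  have "x * y * (b - a)\<^sup>2 \<le> x * y * (r + s)\<^sup>2"
    using nn ab by (intro mult_left_mono power_mono) (auto simp: r_def s_def)
  also have "\<dots> \<le> (x + y) * (x * r\<^sup>2 + y * s\<^sup>2)"
  proof -
    have "(x + y) * (x * r\<^sup>2 + y * s\<^sup>2) - x * y * (r + s)\<^sup>2 = (x * r - y * s)\<^sup>2"
      by (simp add: power2_eq_square algebra_simps)
    then show ?thesis by (metis diff_ge_0_iff_ge zero_le_power2)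
  qed
  also have "\<dots> \<le> 1 * (x * r\<^sup>2 + y * s\<^sup>2)"
    using nn xy by (intro mult_right_mono) auto
  also have "\<dots> = cube_avg E (\<lambda>S. r\<^sup>2 * indicator P S + s\<^sup>2 * indicator Q S)"
    by (simp add: x_def y_def cube_avg_linear)
  also have "\<dots> \<le> cube_avg E (\<lambda>S. (f S - m)\<^sup>2)"
  proof (rule cube_avg_mono)
    fix S assume S: "S \<subseteq> E"
    have "r\<^sup>2 \<le> (f S - m)\<^sup>2" if "S \<in> P"
      using P [OF S that] by (intro abs_le_square_iff [THEN iffD1]) (auto simp: r_def)
    moreover have "s\<^sup>2 \<le> (f S - m)\<^sup>2" if "S \<in> Q"
      using Q [OF S that] by (intro abs_le_square_iff [THEN iffD1]) (auto simp: s_def)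
    ultimately show "r\<^sup>2 * indicator P S + s\<^sup>2 * indicator Q S \<le> (f S - m)\<^sup>2"
      using disj by (auto simp: indicator_def)
  qed
  also have "\<dots> = cube_avg E (\<lambda>S. (f S)\<^sup>2 - (2 * m) * f S + m\<^sup>2)"
    by (rule cube_avg_cong) (simp add: power2_eq_square algebra_simps)
  also have "\<dots> = cube_var E f"
    using E unfolding cube_avg_add cube_avg_diff cube_avg_cmult
    by (simp add: cube_var_def m_def cube_avg_const power2_eq_square)
  finally show ?thesis by (simp add: x_def y_def)
qed

section \<open>Graphs, degree distance and relabeling\<close>

lemma finite_all_edges: "finite V \<Longrightarrow> finite (all_edges V)"
  unfolding all_edges_def by simp

lemma card_all_edges: "finite V \<Longrightarrow> card (all_edges V) = card V choose 2"
  unfolding all_edges_def by (simp add: n_subsets)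

lemma card_edges_at_le:
  assumes "finite V"
  shows "card {e \<in> all_edges V. v \<in> e} \<le> card V"
proof -
  have "{e \<in> all_edges V. v \<in> e} \<subseteq> (\<lambda>w. {v, w}) ` V"
  proof
    fix e assume "e \<in> {e \<in> all_edges V. v \<in> e}"
    then have e: "e \<subseteq> V" "card e = 2" "v \<in> e" by (auto simp: all_edges_def)
    then obtain x y where "e = {x, y}" by (auto simp: card_2_iff)
    with e show "e \<in> (\<lambda>w. {v, w}) ` V" by (auto simp: insert_commute)
  qed
  then show ?thesis
    using assms by (meson card_image_le card_mono finite_imageI le_trans)
qed

lemma graph_measure_eq_cube_avg:
  assumes "finite V"
  shows "graph_measure V A = cube_avg (all_edges V) (indicator A)"
proof -
  have fin: "finite (graphs_on V)" "graphs_on V \<noteq> {}"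
    using assms by (auto simp: graphs_on_def finite_all_edges)
  have "graph_measure V A = card (graphs_on V \<inter> A) / card (graphs_on V)"
    unfolding graph_measure_def using fin by (simp add: measure_pmf_of_set)
  also have "\<dots> = cube_avg (all_edges V) (indicator A)"
  proof -
    have "(\<Sum>G\<in>graphs_on V. indicator A G) = real (card (graphs_on V \<inter> A))"
      using fin(1) by (simp add: indicator_def of_bool_def sum.If_cases)
    then show ?thesis
      using assms by (simp add: cube_avg_def graphs_on_def card_Pow finite_all_edges)
  qed
  finally show ?thesis .
qed

lemma graph_measure_mono: "A \<subseteq> B \<Longrightarrow> graph_measure V A \<le> graph_measure V B"
  unfolding graph_measure_def by (intro measure_pmf.finite_measure_mono) auto

lemma graph_measure_le_1: "graph_measure V A \<le> 1"
  unfolding graph_measure_def by simp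

lemma finite_graphs_on: "finite V \<Longrightarrow> finite (graphs_on V)"
  by (simp add: graphs_on_def finite_all_edges)

lemma finite_graph: "finite V \<Longrightarrow> G \<in> graphs_on V \<Longrightarrow> finite G"
  by (auto simp: graphs_on_def intro: finite_subset finite_all_edges)

lemma degree_sym_diff_le:
  assumes "finite F" "finite F'"
  shows "degree (sym_diff F F') v \<le> degree F v + degree F' v"
proof -
  have "degree (sym_diff F F') v \<le> card ({e \<in> F. v \<in> e} \<union> {e \<in> F'. v \<in> e})"
    unfolding degree_def using assms by (intro card_mono) auto
  also have "\<dots> \<le> degree F v + degree F' v"
    unfolding degree_def by (rule card_Un_le)
  finally show ?thesis .
qed

lemma graph_dist_triangle:
  assumes V: "finite V" "V \<noteq> {}" and G: "G \<in> graphs_on V" "H \<in> graphs_on V" "K \<in> graphs_on V"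
  shows "graph_dist V G K \<le> graph_dist V G H + graph_dist V H K"
proof -
  have fin: "finite G" "finite H" "finite K" using G V by (auto intro: finite_graph)
  have "degree (sym_diff G K) v \<le> graph_dist V G H + graph_dist V H K" if v: "v \<in> V" for v
  proof -
    have "sym_diff G K = sym_diff (sym_diff G H) (sym_diff H K)" by auto
    then have "degree (sym_diff G K) v \<le> degree (sym_diff G H) v + degree (sym_diff H K) v"
      using fin by (metis degree_sym_diff_le finite_Diff finite_Un)
    also have "\<dots> \<le> graph_dist V G H + graph_dist V H K"
      unfolding graph_dist_def max_degree_def using V v by (intro add_mono Max_ge) auto
    finally show ?thesis .
  qed
  then show ?thesis
    using V unfolding graph_dist_def [of V G K] max_degree_def by simp
qed

lemma graph_dist_self: "V \<noteq> {} \<Longrightarrow> graph_dist V G G = 0"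
  by (simp add: graph_dist_def max_degree_def degree_def image_constant_conv)

lemma enlargement_iff:
  assumes "finite V" "A \<subseteq> graphs_on V"
  shows "H \<in> enlargement V A T \<longleftrightarrow> H \<in> graphs_on V \<and> (\<exists>G\<in>A. real (graph_dist V G H) \<le> T)"
proof (cases "A = {}")
  case False
  have fin: "finite ((\<lambda>G. graph_dist V G H) ` A)" "(\<lambda>G. graph_dist V G H) ` A \<noteq> {}"
    using False finite_subset [OF assms(2) finite_graphs_on [OF assms(1)]] by simp_all
  have "real (Min ((\<lambda>G. graph_dist V G H) ` A)) \<le> T \<longleftrightarrow> (\<exists>G\<in>A. real (graph_dist V G H) \<le> T)"
  proof
    assume "real (Min ((\<lambda>G. graph_dist V G H) ` A)) \<le> T"
    then show "\<exists>G\<in>A. real (graph_dist V G H) \<le> T"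
      using Min_in [OF fin] by auto
  next
    assume "\<exists>G\<in>A. real (graph_dist V G H) \<le> T"
    then obtain G where G: "G \<in> A" "real (graph_dist V G H) \<le> T" by blast
    then have "Min ((\<lambda>G. graph_dist V G H) ` A) \<le> graph_dist V G H"
      using fin by (intro Min_le) auto
    with G show "real (Min ((\<lambda>G. graph_dist V G H) ` A)) \<le> T" by linarith
  qed
  with False show ?thesis by (auto simp: enlargement_def)
qed (auto simp: enlargement_def)

lemma enlargement_subset: "enlargement V A T \<subseteq> graphs_on V"
  by (auto simp: enlargement_def)

lemma subset_enlargement:
  assumes "finite V" "V \<noteq> {}" "A \<subseteq> graphs_on V" "0 \<le> T"
  shows "A \<subseteq> enlargement V A T"
proof
  fix G assume "G \<in> A"
  then show "G \<in> enlargement V A T"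
    using assms graph_dist_self [of V G] by (auto simp: enlargement_iff intro!: bexI [of _ G])
qed

lemma enlargement_mono:
  assumes "finite V" "A \<subseteq> graphs_on V" "T \<le> T'"
  shows "enlargement V A T \<subseteq> enlargement V A T'"
  using assms(3) unfolding enlargement_def by auto

lemma enlargement_enlargement:
  assumes "finite V" "V \<noteq> {}" "A \<subseteq> graphs_on V"
  shows "enlargement V (enlargement V A T) T' \<subseteq> enlargement V A (T + T')"
proof
  fix K assume "K \<in> enlargement V (enlargement V A T) T'"
  then obtain H where K: "K \<in> graphs_on V" and H: "H \<in> enlargement V A T" "real (graph_dist V H K) \<le> T'"
    using assms(1) by (auto simp: enlargement_iff [OF _ enlargement_subset])
  from H(1) obtain G where G: "G \<in> A" "real (graph_dist V G H) \<le> T" "H \<in> graphs_on V"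
    using assms by (auto simp: enlargement_iff)
  have "graph_dist V G K \<le> graph_dist V G H + graph_dist V H K"
    using assms G K by (intro graph_dist_triangle) auto
  with G H(2) have "real (graph_dist V G K) \<le> T + T'" by linarith
  with G(1) K assms show "K \<in> enlargement V A (T + T')" by (auto simp: enlargement_iff)
qed

lemma inj_image_permutes: "\<pi> permutes V \<Longrightarrow> inj ((`) \<pi>)"
  by (intro injI) (simp add: inj_image_eq_iff [OF permutes_inj])

lemma bij_betw_image_all_edges:
  assumes "\<pi> permutes V"
  shows "bij_betw ((`) \<pi>) (all_edges V) (all_edges V)"
proof (rule bij_betw_byWitness [where f' = "(`) (inv \<pi>)"])
  have edge: "\<sigma> ` e \<in> all_edges V" if "\<sigma> permutes V" "e \<in> all_edges V" for \<sigma> e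
  proof -
    have "\<sigma> ` e \<subseteq> V"
      using that by (auto simp: all_edges_def permutes_in_image)
    moreover have "card (\<sigma> ` e) = card e"
      using that by (intro card_image) (meson permutes_inj inj_on_subset subset_UNIV)
    ultimately show ?thesis using that by (simp add: all_edges_def)
  qed
  show "(`) \<pi> ` all_edges V \<subseteq> all_edges V"
    "(`) (inv \<pi>) ` all_edges V \<subseteq> all_edges V"
    using edge [OF assms] edge [OF permutes_inv [OF assms]] by auto
qed (simp_all add: image_comp permutes_inv_o [OF assms])

lemma degree_relabel:
  assumes "\<pi> permutes V"
  shows "degree (relabel \<pi> F) (\<pi> v) = degree F v"
proof -
  have inj: "inj \<pi>" using assms by (rule permutes_inj)
  have "{e \<in> relabel \<pi> F. \<pi> v \<in> e} = (`) \<pi> ` {e \<in> F. v \<in> e}"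
    using inj_image_mem_iff [OF inj, of v] unfolding relabel_def by blast
  moreover have "inj_on ((`) \<pi>) {e \<in> F. v \<in> e}"
    using inj_image_permutes [OF assms] by (rule inj_on_subset) simp
  ultimately show ?thesis
    by (simp add: degree_def card_image)
qed

lemma relabel_sym_diff:
  assumes "\<pi> permutes V"
  shows "relabel \<pi> (sym_diff F F') = sym_diff (relabel \<pi> F) (relabel \<pi> F')"
  unfolding relabel_def using inj_image_permutes [OF assms]
  by (simp add: image_Un image_set_diff)

lemma graph_dist_relabel:
  assumes "\<pi> permutes V"
  shows "graph_dist V (relabel \<pi> G) (relabel \<pi> H) = graph_dist V G H"
proof -
  have "degree (sym_diff (relabel \<pi> G) (relabel \<pi> H)) ` V
      = degree (relabel \<pi> (sym_diff G H)) ` (\<pi> ` V)"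
    by (simp only: relabel_sym_diff [OF assms] permutes_image [OF assms])
  also have "\<dots> = degree (sym_diff G H) ` V"
    by (simp only: image_image degree_relabel [OF assms])
  finally show ?thesis by (simp add: graph_dist_def max_degree_def)
qed

lemma relabel_in_graphs_on:
  assumes "\<pi> permutes V" "G \<in> graphs_on V"
  shows "relabel \<pi> G \<in> graphs_on V"
  using assms bij_betw_image_all_edges [OF assms(1)]
  by (auto simp: graphs_on_def relabel_def bij_betw_def)

lemma relabel_invariant_enlargement:
  assumes "finite V" "A \<subseteq> graphs_on V" "relabel_invariant V A"
  shows "relabel_invariant V (enlargement V A T)"
  unfolding relabel_invariant_def
proof (intro allI impI ballI)
  fix \<pi> H assume \<pi>: "\<pi> permutes V" and H: "H \<in> enlargement V A T"
  then obtain G where "G \<in> A" "real (graph_dist V G H) \<le> T" "H \<in> graphs_on V"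
    using assms by (auto simp: enlargement_iff)
  then have "relabel \<pi> G \<in> A" "real (graph_dist V (relabel \<pi> G) (relabel \<pi> H)) \<le> T"
      "relabel \<pi> H \<in> graphs_on V"
    using assms(3) \<pi> by (auto simp: relabel_invariant_def graph_dist_relabel relabel_in_graphs_on)
  then show "relabel \<pi> H \<in> enlargement V A T"
    using assms by (auto simp: enlargement_iff)
qed

lemma relabel_image_invariant:
  assumes "finite V" "A \<subseteq> graphs_on V" "relabel_invariant V A" "\<pi> permutes V"
  shows "relabel \<pi> ` A = A"
proof (rule endo_inj_surj)
  show "finite A" using assms by (auto intro: finite_subset finite_graphs_on)
  show "relabel \<pi> ` A \<subseteq> A" using assms by (auto simp: relabel_invariant_def)
  show "inj_on (relabel \<pi>) A"
    by (intro inj_onI)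
      (simp add: relabel_def inj_image_eq_iff [OF inj_image_permutes [OF assms(4)]])
qed

lemma edge_transitive:
  assumes V: "finite V" and e: "e \<in> all_edges V" "e' \<in> all_edges V"
  obtains \<pi> where "\<pi> permutes V" "\<pi> ` e = e'"
proof -
  have sub: "e \<subseteq> V" "e' \<subseteq> V" and card: "card e = card e'"
    using e by (auto simp: all_edges_def)
  have fin: "finite e" "finite e'" using sub V by (auto intro: finite_subset)
  obtain f where f: "bij_betw f e e'"
    using finite_same_card_bij [OF fin card] by blast
  have "card (V - e) = card (V - e')"
    using sub card fin by (simp add: card_Diff_subset)
  then obtain g where g: "bij_betw g (V - e) (V - e')"
    using finite_same_card_bij [of "V - e" "V - e'"] V by auto
  define \<pi> where "\<pi> x = (if x \<in> e then f x else if x \<in> V then g x else x)" for x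
  have "bij_betw \<pi> e e'"
    using f by (rule bij_betw_cong [THEN iffD1, rotated]) (simp add: \<pi>_def)
  moreover have "bij_betw \<pi> (V - e) (V - e')"
    using g by (rule bij_betw_cong [THEN iffD1, rotated]) (simp add: \<pi>_def)
  ultimately have "bij_betw \<pi> (e \<union> (V - e)) (e' \<union> (V - e'))"
    by (rule bij_betw_combine) auto
  then have "bij_betw \<pi> V V"
    using sub by (simp add: Un_absorb1)
  then have "\<pi> permutes V"
    using sub by (intro bij_imp_permutes) (auto simp: \<pi>_def)
  moreover have "\<pi> ` e = e'"
    using \<open>bij_betw \<pi> e e'\<close> by (simp add: bij_betw_def)
  ultimately show ?thesis using that by blast
qed

section \<open>The soft maximum degree\<close>

text \<open>
The log-sum-exp of the degrees, a smooth majorant of the maximum degree that exceeds it by at most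
\<open>ln n\<close>.  This error is negligible against \<open>sqrt (n / ln n)\<close>, so the inverse temperature can be taken
to be 1.
\<close>
definition soft_max_degree :: "'a set \<Rightarrow> 'a graph \<Rightarrow> real" where
  "soft_max_degree V F = ln (\<Sum>v\<in>V. exp (real (degree F v)))"

text \<open>
The gradient of log-sum-exp: a probability distribution on the vertices.
\<close>
definition soft_weight :: "'a set \<Rightarrow> 'a graph \<Rightarrow> 'a \<Rightarrow> real" where
  "soft_weight V F v = exp (real (degree F v)) / (\<Sum>w\<in>V. exp (real (degree F w)))"

lemma max_degree_le_soft:
  assumes "finite V" "V \<noteq> {}"
  shows "real (max_degree V F) \<le> soft_max_degree V F"
proof -
  have "max_degree V F \<in> degree F ` V"
    unfolding max_degree_def using assms by (intro Max_in) auto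
  then obtain v where v: "v \<in> V" "max_degree V F = degree F v" by auto
  have "exp (real (degree F v)) \<le> (\<Sum>v\<in>V. exp (real (degree F v)))"
    using assms v by (intro member_le_sum) auto
  then show ?thesis
    using v by (simp add: soft_max_degree_def ln_ge_iff less_le_trans [OF exp_gt_zero])
qed

lemma soft_max_degree_empty: "soft_max_degree V {} = ln (real (card V))"
  by (simp add: soft_max_degree_def degree_def)

lemma soft_max_degree_relabel:
  assumes "\<pi> permutes V"
  shows "soft_max_degree V (relabel \<pi> F) = soft_max_degree V F"
proof -
  have "(\<Sum>v\<in>V. exp (real (degree (relabel \<pi> F) v)))
      = (\<Sum>v\<in>V. exp (real (degree (relabel \<pi> F) (\<pi> v))))"
    by (rule sum.permute [OF assms, unfolded comp_def])
  then show ?thesis by (simp add: soft_max_degree_def degree_relabel [OF assms])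
qed

lemma soft_weight_sum:
  assumes "finite V" "V \<noteq> {}"
  shows "(\<Sum>v\<in>V. soft_weight V F v) = 1"
proof -
  have "(\<Sum>w\<in>V. exp (real (degree F w))) > 0"
    using assms by (intro sum_pos) auto
  then show ?thesis by (simp add: soft_weight_def sum_divide_distrib [symmetric])
qed

lemma soft_weight_nonneg: "0 \<le> soft_weight V F v"
  by (simp add: soft_weight_def sum_nonneg)

text \<open>
Flipping e raises the degrees by at most one, and only at the endpoints.  So the exponential sum grows
at most by the factor \<open>1 + (exp 1 - 1) W\<close>, where \<open>W \<le> 1\<close> is the weight of the endpoints.
\<close>
lemma soft_max_degree_flip:
  assumes V: "finite V" "V \<noteq> {}" and F: "finite F"
  shows "soft_max_degree V (sym_diff F {e}) - soft_max_degree V F \<le> 2 * (\<Sum>v\<in>V \<inter> e. soft_weight V F v)"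
    and "soft_max_degree V (sym_diff F {e}) - soft_max_degree V F \<le> 1"
proof -
  define Z where "Z = (\<Sum>v\<in>V. exp (real (degree F v)))"
  define Z' where "Z' = (\<Sum>v\<in>V. exp (real (degree (sym_diff F {e}) v)))"
  define W where "W = (\<Sum>v\<in>V \<inter> e. soft_weight V F v)"
  have Z: "Z > 0" "Z' > 0" unfolding Z_def Z'_def using V by (auto intro!: sum_pos)
  have W0: "0 \<le> W" unfolding W_def by (intro sum_nonneg soft_weight_nonneg)
  have W1: "W \<le> 1"
    unfolding W_def soft_weight_sum [OF V, of F, symmetric]
    using V by (intro sum_mono2 soft_weight_nonneg) auto
  have deg: "degree (sym_diff F {e}) v \<le> degree F v + (if v \<in> e then 1 else 0)" for v
  proof -
    have "degree {e} v = (if v \<in> e then 1 else 0)"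
    proof (cases "v \<in> e")
      case True
      then have "{f \<in> {e}. v \<in> f} = {e}" by auto
      with True show ?thesis by (simp add: degree_def)
    qed (auto simp: degree_def)
    with degree_sym_diff_le [of F "{e}" v] F show ?thesis by simp
  qed
  have "Z' \<le> (\<Sum>v\<in>V. exp (real (degree F v)) + (exp 1 - 1) * (if v \<in> e then exp (real (degree F v)) else 0))"
    unfolding Z'_def
  proof (rule sum_mono)
    fix v
    have "exp (real (degree (sym_diff F {e}) v)) \<le> exp (real (degree F v + (if v \<in> e then 1 else 0)))"
      using deg [of v] by simp
    also have "\<dots> = exp (real (degree F v)) + (exp 1 - 1) * (if v \<in> e then exp (real (degree F v)) else 0)"
      by (simp add: exp_add algebra_simps)
    finally show "exp (real (degree (sym_diff F {e}) v))
       \<le> exp (real (degree F v)) + (exp 1 - 1) * (if v \<in> e then exp (real (degree F v)) else 0)" .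
  qed
  also have "\<dots> = Z + (exp 1 - 1) * (\<Sum>v\<in>V \<inter> e. exp (real (degree F v)))"
    using V by (simp add: sum.distrib Z_def sum_distrib_left [symmetric] sum.inter_restrict)
  also have "(\<Sum>v\<in>V \<inter> e. exp (real (degree F v))) = W * Z"
    using Z by (simp add: W_def soft_weight_def Z_def [symmetric] sum_divide_distrib [symmetric])
  finally have "Z' / Z \<le> 1 + (exp 1 - 1) * W"
    using Z by (simp add: field_simps)
  moreover have "soft_max_degree V (sym_diff F {e}) - soft_max_degree V F = ln (Z' / Z)"
    using Z by (simp add: soft_max_degree_def Z_def Z'_def ln_div)
  ultimately have le: "soft_max_degree V (sym_diff F {e}) - soft_max_degree V F \<le> ln (1 + (exp 1 - 1) * W)"
    using Z W0 by (simp add: ln_le_cancel_iff add_pos_nonneg)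
  have e3: "exp 1 - 1 \<le> (2::real)" using exp_le by simp
  have "ln (1 + (exp 1 - 1) * W) \<le> (exp 1 - 1) * W"
    using W0 by (intro ln_add_one_self_le_self) simp
  also have "\<dots> \<le> 2 * W" using e3 W0 by (intro mult_right_mono)
  finally show "soft_max_degree V (sym_diff F {e}) - soft_max_degree V F \<le> 2 * (\<Sum>v\<in>V \<inter> e. soft_weight V F v)"
    using le by (simp add: W_def)
  have "1 + (exp 1 - 1) * W \<le> 1 + (exp 1 - 1) * 1"
    using W1 by (intro add_left_mono mult_left_mono) auto
  also have "\<dots> = exp (1::real)" by simp
  finally have "1 + (exp 1 - 1) * W \<le> exp 1" .
  moreover have "0 < 1 + (exp 1 - 1) * W"
    using W0 by (intro add_pos_nonneg) auto
  ultimately have "ln (1 + (exp 1 - 1) * W) \<le> ln (exp 1)"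
    by (subst ln_le_cancel_iff) auto
  then show "soft_max_degree V (sym_diff F {e}) - soft_max_degree V F \<le> 1"
    using le by simp
qed

text \<open>
The weights have total 1 and each vertex lies on fewer than n of the possible edges.  So, although
there are quadratically many edges, the increases have a sum that is only linear in n.
\<close>
lemma soft_max_degree_total_increase:
  assumes V: "finite V" "V \<noteq> {}" and F: "finite F"
  shows "(\<Sum>e\<in>all_edges V. max 0 (soft_max_degree V (sym_diff F {e}) - soft_max_degree V F))
     \<le> 2 * real (card V)"
proof -
  have fin: "finite (all_edges V)" using V by (simp add: finite_all_edges)
  have "(\<Sum>e\<in>all_edges V. max 0 (soft_max_degree V (sym_diff F {e}) - soft_max_degree V F))
      \<le> (\<Sum>e\<in>all_edges V. 2 * (\<Sum>v\<in>V \<inter> e. soft_weight V F v))"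
    using soft_max_degree_flip(1) [OF assms]
    by (intro sum_mono max.boundedI) (auto intro: sum_nonneg soft_weight_nonneg)
  also have "\<dots> = 2 * (\<Sum>v\<in>V. \<Sum>e\<in>all_edges V. if v \<in> e then soft_weight V F v else 0)"
    using V by (subst sum.swap) (simp add: sum_distrib_left [symmetric] sum.inter_restrict)
  also have "\<dots> = 2 * (\<Sum>v\<in>V. soft_weight V F v * card {e \<in> all_edges V. v \<in> e})"
    using fin by (simp add: sum.inter_filter [symmetric] mult.commute)
  also have "\<dots> \<le> 2 * (\<Sum>v\<in>V. soft_weight V F v * card V)"
    using V by (intro mult_left_mono sum_mono) (auto simp: card_edges_at_le soft_weight_nonneg)
  also have "\<dots> = 2 * real (card V)"
    using soft_weight_sum [OF V, of F] by (simp add: sum_distrib_right [symmetric])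
  finally show ?thesis .
qed

section \<open>The soft distance to a family and expansion\<close>

text \<open>
The distance from G to the family A, with the maximum degree replaced by its smooth majorant.
\<close>
definition soft_dist :: "'a set \<Rightarrow> 'a graph set \<Rightarrow> 'a graph \<Rightarrow> real" where
  "soft_dist V A G = Min ((\<lambda>H. soft_max_degree V (sym_diff H G)) ` A)"

locale graph_family =
  fixes V :: "'a set" and A :: "'a graph set"
  assumes finV: "finite V" and neV: "V \<noteq> {}"
    and sub: "A \<subseteq> graphs_on V" and neA: "A \<noteq> {}"
begin

lemma finA: "finite A"
  using finite_subset [OF sub finite_graphs_on [OF finV]] .

lemma soft_dist_le: "H \<in> A \<Longrightarrow> soft_dist V A G \<le> soft_max_degree V (sym_diff H G)"
  unfolding soft_dist_def using finA by (intro Min_le) auto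

lemma soft_dist_attained:
  obtains H where "H \<in> A" "soft_dist V A G = soft_max_degree V (sym_diff H G)"
proof -
  have "soft_dist V A G \<in> (\<lambda>H. soft_max_degree V (sym_diff H G)) ` A"
    unfolding soft_dist_def using finA neA by (intro Min_in) auto
  then show ?thesis using that by blast
qed

text \<open>
The minimizing H for G remains a competitor after a flip, so the increase of the distance is at most the
increase of the soft maximum degree of the difference graph F of H and G.
\<close>
lemma soft_dist_flip_majorant:
  assumes "G \<in> graphs_on V"
  obtains F where "finite F"
    and "\<And>e. soft_dist V A (sym_diff G {e}) - soft_dist V A G
          \<le> soft_max_degree V (sym_diff F {e}) - soft_max_degree V F"
proof -
  obtain H where H: "H \<in> A" "soft_dist V A G = soft_max_degree V (sym_diff H G)"
    by (rule soft_dist_attained)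
  have "finite (sym_diff H G)"
    using H(1) sub assms finV by (auto intro: finite_graph)
  moreover have "soft_dist V A (sym_diff G {e}) - soft_dist V A G
      \<le> soft_max_degree V (sym_diff (sym_diff H G) {e}) - soft_max_degree V (sym_diff H G)" for e
  proof -
    have "sym_diff H (sym_diff G {e}) = sym_diff (sym_diff H G) {e}" by auto
    with soft_dist_le [OF H(1), of "sym_diff G {e}"] H(2) show ?thesis by simp
  qed
  ultimately show ?thesis by (rule that)
qed

lemma soft_dist_flip_le_1:
  assumes "G \<in> graphs_on V"
  shows "soft_dist V A (sym_diff G {e}) \<le> soft_dist V A G + 1"
proof -
  obtain F where "finite F" and "soft_dist V A (sym_diff G {e}) - soft_dist V A G
          \<le> soft_max_degree V (sym_diff F {e}) - soft_max_degree V F"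
    using soft_dist_flip_majorant [OF assms] by blast
  with soft_max_degree_flip(2) [OF finV neV, of F e] show ?thesis by linarith
qed

lemma soft_dist_total_increase:
  assumes "G \<in> graphs_on V"
  shows "(\<Sum>e\<in>all_edges V. max 0 (soft_dist V A (sym_diff G {e}) - soft_dist V A G))
     \<le> 2 * real (card V)"
proof -
  obtain F where F: "finite F" "\<And>e. soft_dist V A (sym_diff G {e}) - soft_dist V A G
          \<le> soft_max_degree V (sym_diff F {e}) - soft_max_degree V F"
    using soft_dist_flip_majorant [OF assms] by blast
  show ?thesis
    by (rule order_trans [OF _ soft_max_degree_total_increase [OF finV neV F(1)]])
      (intro sum_mono max.mono order_refl F(2))
qed

lemma soft_dist_member: "G \<in> A \<Longrightarrow> soft_dist V A G \<le> ln (real (card V))"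
  using soft_dist_le [of G G] by (simp add: soft_max_degree_empty)

lemma soft_dist_outside_enlargement:
  assumes "G \<in> graphs_on V" "G \<notin> enlargement V A T"
  shows "T < soft_dist V A G"
proof -
  obtain H where H: "H \<in> A" "soft_dist V A G = soft_max_degree V (sym_diff H G)"
    by (rule soft_dist_attained)
  have "T < real (graph_dist V H G)"
    using assms H(1) by (auto simp: enlargement_iff [OF finV sub] not_le)
  also have "\<dots> \<le> soft_dist V A G"
    unfolding H(2) graph_dist_def by (rule max_degree_le_soft [OF finV neV])
  finally show ?thesis .
qed

lemma soft_dist_relabel:
  assumes "relabel_invariant V A" "\<pi> permutes V"
  shows "soft_dist V A (relabel \<pi> G) = soft_dist V A G"
proof -
  have "(\<lambda>H. soft_max_degree V (sym_diff H (relabel \<pi> G))) ` A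
      = (\<lambda>H. soft_max_degree V (sym_diff H (relabel \<pi> G))) ` (relabel \<pi> ` A)"
    by (simp only: relabel_image_invariant [OF finV sub assms])
  also have "\<dots> = (\<lambda>H. soft_max_degree V (sym_diff H G)) ` A"
    by (simp only: image_image relabel_sym_diff [OF assms(2), symmetric]
        soft_max_degree_relabel [OF assms(2)])
  finally show ?thesis by (simp add: soft_dist_def)
qed

text \<open>
Truncation from above confines the increases to the enlargement.  Truncation from below, one unit
above the largest value that the soft distance can take on A, confines them to the complement of A.
\<close>
definition level :: "real \<Rightarrow> 'a graph \<Rightarrow> real" where
  "level T G = max (ln (real (card V)) + 1) (min (soft_dist V A G) T)"

text \<open>
On A one flip cannot lift the soft distance above the lower cutoff, and outside the enlargement the
upper cutoff is already attained.  Elsewhere truncation does not enlarge increases.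
\<close>
lemma level_increase:
  assumes G: "G \<in> graphs_on V" and T: "ln (real (card V)) + 1 \<le> T"
  shows "max 0 (level T (sym_diff G {e}) - level T G)
    \<le> indicator (enlargement V A T - A) G * max 0 (soft_dist V A (sym_diff G {e}) - soft_dist V A G)"
proof (cases "G \<in> enlargement V A T - A")
  case True
  then show ?thesis by (auto simp: level_def)
next
  case False
  have "level T (sym_diff G {e}) \<le> level T G"
  proof (cases "G \<in> A")
    case True
    then have "soft_dist V A (sym_diff G {e}) \<le> ln (real (card V)) + 1"
      using soft_dist_flip_le_1 [OF G, of e] soft_dist_member by fastforce
    then show ?thesis by (auto simp: level_def)
  next
    case False
    with \<open>G \<notin> enlargement V A T - A\<close> have "T < soft_dist V A G"
      using soft_dist_outside_enlargement [OF G] by auto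
    then show ?thesis using T by (auto simp: level_def)
  qed
  with False show ?thesis by simp
qed

lemma level_diff_le_1:
  assumes "G \<in> graphs_on V" "e \<in> all_edges V"
  shows "\<bar>cube_diff e (level T) G\<bar> \<le> 1"
proof -
  define G' where "G' = sym_diff G {e}"
  have "G' \<in> graphs_on V" "sym_diff G' {e} = G"
    using assms by (auto simp: G'_def graphs_on_def)
  then have "soft_dist V A G' \<le> soft_dist V A G + 1" "soft_dist V A G \<le> soft_dist V A G' + 1"
    using soft_dist_flip_le_1 [OF assms(1), of e] soft_dist_flip_le_1 [of G' e]
    by (simp_all add: G'_def)
  then show ?thesis
    unfolding abs_cube_diff G'_def [symmetric] by (auto simp: level_def max_def min_def abs_if)
qed

lemma level_total_influence:
  assumes T: "ln (real (card V)) + 1 \<le> T"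
  shows "(\<Sum>e\<in>all_edges V. cube_avg (all_edges V) (\<lambda>G. \<bar>cube_diff e (level T) G\<bar>))
    \<le> 4 * real (card V) * graph_measure V (enlargement V A T - A)"
proof -
  define E where "E = all_edges V"
  have fin: "finite E" using finV by (simp add: E_def finite_all_edges)
  have "(\<Sum>e\<in>E. cube_avg E (\<lambda>G. \<bar>cube_diff e (level T) G\<bar>))
      = 2 * cube_avg E (\<lambda>G. \<Sum>e\<in>E. max 0 (level T (sym_diff G {e}) - level T G))"
    by (simp add: cube_avg_abs_diff [OF fin] cube_avg_sum sum_distrib_left)
  also have "\<dots> \<le> 2 * cube_avg E (\<lambda>G. (2 * real (card V)) * indicator (enlargement V A T - A) G)"
  proof (intro mult_left_mono cube_avg_mono)
    fix G assume "G \<subseteq> E"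
    then have G: "G \<in> graphs_on V" by (simp add: graphs_on_def E_def)
    have "(\<Sum>e\<in>E. max 0 (level T (sym_diff G {e}) - level T G))
       \<le> indicator (enlargement V A T - A) G *
          (\<Sum>e\<in>E. max 0 (soft_dist V A (sym_diff G {e}) - soft_dist V A G))"
      unfolding sum_distrib_left by (intro sum_mono level_increase G T)
    also have "\<dots> \<le> indicator (enlargement V A T - A) G * (2 * real (card V))"
      unfolding E_def by (intro mult_left_mono soft_dist_total_increase G) simp
    finally show "(\<Sum>e\<in>E. max 0 (level T (sym_diff G {e}) - level T G))
        \<le> (2 * real (card V)) * indicator (enlargement V A T - A) G"
      by (simp add: mult.commute)
  qed simp
  also have "\<dots> = 4 * real (card V) * graph_measure V (enlargement V A T - A)"
    by (simp add: cube_avg_cmult graph_measure_eq_cube_avg [OF finV] E_def)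
  finally show ?thesis unfolding E_def .
qed

lemma level_relabel:
  "relabel_invariant V A \<Longrightarrow> \<pi> permutes V \<Longrightarrow> level T (relabel \<pi> G) = level T G"
  by (simp add: level_def soft_dist_relabel)

text \<open>
Relabeling acts transitively on the possible edges, so all influences are equal.  Their total is
of order \<open>n d\<close>, with d the mass of the shell between A and its enlargement, and there are about
\<open>n\<^sup>2 / 2\<close> of them.  The choice \<open>l = ln n\<close> makes both terms of the variance bound of order \<open>n d\<close>.  The
factor \<open>ln n\<close> gained on the left is the saving over the bound without symmetry.
\<close>
lemma level_variance:
  assumes inv: "relabel_invariant V A" and n: "card V \<ge> 2"
    and T: "ln (real (card V)) + 1 \<le> T"
  shows "ln (real (card V)) * cube_var (all_edges V) (level T)
    \<le> 12 * real (card V) * graph_measure V (enlargement V A T - A)"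
proof -
  define E where "E = all_edges V"
  define n where "n = real (card V)"
  define d where "d = graph_measure V (enlargement V A T - A)"
  have n2: "n \<ge> 2" using n by (simp add: n_def)
  have d: "0 \<le> d" "d \<le> 1"
    using graph_measure_le_1 by (auto simp: d_def graph_measure_def)
  have fin: "finite E" using finV by (simp add: E_def finite_all_edges)
  have "card E = card V choose 2" using finV by (simp add: E_def card_all_edges)
  then have cardE: "real (card E) = n * (n - 1) / 2"
    using n by (simp add: n_def choose_two real_of_nat_div of_nat_diff)
  have N: "n\<^sup>2 / 4 \<le> real (card E)"
  proof -
    have "0 \<le> n * (n - 2)" using n2 by simp
    then show ?thesis by (simp add: cardE power2_eq_square field_simps)
  qed
  then have cpos: "real (card E) > 0" using n2 by (smt (verit) divide_pos_pos zero_less_power)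
  have neE: "E \<noteq> {}" using cpos by auto
  have equal: "cube_avg E (\<lambda>S. \<bar>cube_diff e (level T) S\<bar>) = cube_avg E (\<lambda>S. \<bar>cube_diff e' (level T) S\<bar>)"
    if e: "e \<in> E" "e' \<in> E" for e e'
  proof -
    obtain \<pi> where \<pi>: "\<pi> permutes V" "\<pi> ` e = e'"
      by (rule edge_transitive [OF finV e [unfolded E_def]])
    have "cube_avg E (\<lambda>S. \<bar>cube_diff (\<pi> ` e) (level T) S\<bar>) = cube_avg E (\<lambda>S. \<bar>cube_diff e (level T) S\<bar>)"
      using bij_betw_image_all_edges [OF \<pi>(1)] e(1) level_relabel [OF inv \<pi>(1), of T]
      unfolding E_def relabel_def by (intro influence_automorphism) auto
    with \<pi>(2) show ?thesis by simp
  qed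
  have "ln n * cube_var E (level T)
      \<le> 4 * n * d + exp (ln n - 1) / 4 * ((4 * n * d)\<^sup>2 / card E)"
  proof (rule variance_bound_equal_influences [OF fin neE _ equal])
    show "\<bar>cube_diff e (level T) S\<bar> \<le> 1" if "e \<in> E" "S \<subseteq> E" for e S
      using that by (intro level_diff_le_1) (auto simp: E_def graphs_on_def)
    show "(\<Sum>e\<in>E. cube_avg E (\<lambda>S. \<bar>cube_diff e (level T) S\<bar>)) \<le> 4 * n * d"
      unfolding E_def n_def d_def by (rule level_total_influence [OF T])
  qed
  also have "\<dots> \<le> 4 * n * d + (n / 2) / 4 * (64 * d)"
  proof (intro add_mono order_refl mult_mono divide_right_mono)
    have "exp (ln n - 1) = n / exp 1" using n2 by (simp add: exp_diff)
    also have "\<dots> \<le> n / 2"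
      using exp_ge_add_one_self [of "1::real"] n2 by (intro divide_left_mono) auto
    finally show "exp (ln n - 1) \<le> n / 2" .
    have "(4 * n * d)\<^sup>2 / card E \<le> (4 * n * d)\<^sup>2 / (n\<^sup>2 / 4)"
      using N n2 cpos by (intro divide_left_mono) auto
    also have "\<dots> = 64 * (d * d)"
      using n2 by (simp add: power2_eq_square field_simps)
    also have "\<dots> \<le> 64 * d" using d mult_left_mono [of d 1 d] by simp
    finally show "(4 * n * d)\<^sup>2 / card E \<le> 64 * d" .
  qed (use n2 in auto)
  also have "\<dots> = 12 * n * d" by simp
  finally show ?thesis by (simp add: E_def n_def d_def)
qed

text \<open>
The level function separates A from the complement of its enlargement by a gap of at least
\<open>5 sqrt (n / ln n)\<close>, so its variance is at least \<open>25 x y n / ln n\<close> with x and y the masses of these two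
sets.  Comparison with the upper bound shows that the shell has mass at least \<open>2 x y\<close>.
\<close>
lemma expansion_step:
  assumes inv: "relabel_invariant V A" and n: "card V \<ge> 2"
    and T: "T \<ge> 12 * sqrt (real (card V) / ln (real (card V)))"
  shows "2 * graph_measure V A * (1 - graph_measure V (enlargement V A T))
    \<le> graph_measure V (enlargement V A T) - graph_measure V A"
proof -
  define n where "n = real (card V)"
  define s where "s = sqrt (n / ln n)"
  define L where "L = T - (ln n + 1)"
  define x y where "x = graph_measure V A" and "y = graph_measure V (graphs_on V - enlargement V A T)"
  have n2: "n \<ge> 2" using n by (simp add: n_def)
  have ln: "ln n > 0" using n2 by simp
  have s2: "s\<^sup>2 = n / ln n" using ln n2 by (simp add: s_def)
  have s0: "s \<ge> 0" using ln n2 by (simp add: s_def)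
  have s1: "1 \<le> s"
    using ln less_imp_le [OF ln_less_self, of n] n2 by (simp add: s_def)
  \<comment> \<open>After squaring and clearing the denominator: \<open>(ln n)\<^sup>3 \<le> 36 n\<close>.  It is obtained from
    \<open>ln u \<le> u\<close> at the cube root of n.\<close>
  have s6: "ln n \<le> 6 * s"
  proof -
    have "ln n = 3 * ln (root 3 n)" using n2 by (simp add: ln_root)
    also have "\<dots> \<le> 3 * root 3 n" using n2 less_imp_le [OF ln_less_self, of "root 3 n"] by simp
    finally have "(ln n) ^ 3 \<le> (3 * root 3 n) ^ 3" using ln by (intro power_mono) auto
    also have "\<dots> = 27 * n" using n2 by (simp add: power_mult_distrib)
    also have "\<dots> \<le> 36 * n" using n2 by simp
    finally have "(ln n)\<^sup>2 \<le> 36 * (n / ln n)"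
      using ln by (simp add: field_simps power2_eq_square power3_eq_cube)
    then have "(ln n)\<^sup>2 \<le> (6 * s)\<^sup>2"
      by (simp add: power_mult_distrib s2)
    then show ?thesis by (rule power2_le_imp_le) (use s0 in simp)
  qed
  have Ts: "12 * s \<le> T" using T by (simp add: s_def n_def)
  have L: "5 * s \<le> L" using s1 s6 Ts by (simp add: L_def)
  then have T': "ln (real (card V)) + 1 \<le> T" using s0 by (simp add: L_def n_def)
  have T0: "0 \<le> T" using Ts s0 by simp
  have sube: "A \<subseteq> enlargement V A T" by (rule subset_enlargement [OF finV neV sub T0])
  have d: "graph_measure V (enlargement V A T - A) = graph_measure V (enlargement V A T) - x"
    unfolding graph_measure_def x_def
    using sube by (intro measure_pmf.finite_measure_Diff) auto
  have y: "y = 1 - graph_measure V (enlargement V A T)"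
  proof -
    have "measure_pmf.prob (pmf_of_set (graphs_on V)) (graphs_on V) = 1"
      using finite_graphs_on [OF finV] sub neA by (subst measure_pmf_of_set) auto
    then show ?thesis
      unfolding graph_measure_def y_def using enlargement_subset
      by (subst measure_pmf.finite_measure_Diff) auto
  qed
  have "x * y * L\<^sup>2 \<le> cube_var (all_edges V) (level T)"
    unfolding x_def y_def graph_measure_eq_cube_avg [OF finV] L_def
  proof (rule variance_lower_bound_two_sets)
    show "finite (all_edges V)" using finV by (rule finite_all_edges)
    show "A \<inter> (graphs_on V - enlargement V A T) = {}" using sube by auto
    show "ln n + 1 \<le> T" using T' by (simp add: n_def)
    show "level T G \<le> ln n + 1" if "G \<in> A" for G
      using soft_dist_member [OF that] by (auto simp: level_def n_def)
    show "T \<le> level T G" if "G \<in> graphs_on V - enlargement V A T" for G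
      using that soft_dist_outside_enlargement [of G T] by (auto simp: level_def)
  qed
  then have "ln n * (x * y * L\<^sup>2) \<le> ln n * cube_var (all_edges V) (level T)"
    using ln by simp
  also have "\<dots> \<le> 12 * n * (graph_measure V (enlargement V A T) - x)"
    using level_variance [OF inv n T'] by (simp add: n_def d)
  finally have "ln n * (x * y * L\<^sup>2) \<le> 12 * n * (graph_measure V (enlargement V A T) - x)" .
  moreover have "ln n * (x * y * (5 * s)\<^sup>2) \<le> ln n * (x * y * L\<^sup>2)"
    using L s0 ln by (intro mult_left_mono power_mono) (auto simp: x_def y_def graph_measure_def)
  moreover have "ln n * (x * y * (5 * s)\<^sup>2) = n * (25 * (x * y))"
    using ln by (simp add: power_mult_distrib s2 field_simps)
  ultimately have "n * (25 * (x * y)) \<le> n * (12 * (graph_measure V (enlargement V A T) - x))"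
    by (simp only: mult.assoc [of 12 n] mult.left_commute [of 12 n])
  then have "25 * (x * y) \<le> 12 * (graph_measure V (enlargement V A T) - x)"
    using n2 by (simp add: mult_le_cancel_left_pos)
  moreover have "0 \<le> x * y" by (simp add: x_def y_def graph_measure_def)
  ultimately have "2 * (x * y) \<le> graph_measure V (enlargement V A T) - x"
    by argo
  then show ?thesis by (simp add: x_def y mult.assoc)
qed

end

section \<open>Iteration\<close>

text \<open>
Write x and x' for the masses before and after a step.  The inequality \<open>2 x (1 - x') \<le> x' - x\<close>
rearranges to \<open>3 x (1 - x') \<le> (1 - x) x'\<close>: a step at least triples the odds \<open>x / (1 - x)\<close>, whether x is
close to 0 or to 1.  So one induction covers both the growth from \<open>\<epsilon>\<close> to one half and the
shrinking of the complement back to \<open>\<epsilon>\<close>.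
\<close>
lemma iterated_expansion:
  assumes V: "finite V" "card V \<ge> 2" and A: "A \<subseteq> graphs_on V" "relabel_invariant V A"
    and \<epsilon>: "0 < \<epsilon>" "\<epsilon> \<le> graph_measure V A"
    and T: "T = 12 * sqrt (real (card V) / ln (real (card V)))"
  shows "\<epsilon> * 3 ^ k * (1 - graph_measure V (enlargement V A (k * T)))
    \<le> graph_measure V (enlargement V A (k * T))"
proof (induction k)
  case 0
  have neV: "V \<noteq> {}" using V by auto
  have "graph_measure V A \<le> graph_measure V (enlargement V A 0)"
    by (intro graph_measure_mono subset_enlargement V neV A) simp
  moreover have "\<epsilon> * (1 - graph_measure V (enlargement V A 0)) \<le> \<epsilon> * 1"
    using \<epsilon> by (intro mult_left_mono) (auto simp: graph_measure_def)
  ultimately have "\<epsilon> * (1 - graph_measure V (enlargement V A 0)) \<le> graph_measure V (enlargement V A 0)"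
    using \<epsilon> by linarith
  then show ?case by simp
next
  case (Suc k)
  have neV: "V \<noteq> {}" using V by auto
  have T0: "0 \<le> T" using V by (simp add: T)
  define B where "B = enlargement V A (k * T)"
  define x x' where "x = graph_measure V B" and "x' = graph_measure V (enlargement V B T)"
  have "A \<subseteq> B" unfolding B_def using T0 by (intro subset_enlargement V neV A) simp
  then have xpos: "x > 0" using graph_measure_mono [of A B V] \<epsilon> by (simp add: x_def)
  then have neB: "B \<noteq> {}" by (auto simp: x_def graph_measure_def)
  interpret B: graph_family V B
    using V neV neB by unfold_locales (auto simp: B_def enlargement_subset)
  have "2 * x * (1 - x') \<le> x' - x"
    unfolding x_def x'_def using V T
    by (intro B.expansion_step) (simp_all add: B_def relabel_invariant_enlargement A)
  then have tri: "3 * (1 - x') * x \<le> (1 - x) * x'"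
    by (simp add: algebra_simps)
  have "(\<epsilon> * 3 ^ Suc k * (1 - x')) * x = \<epsilon> * 3 ^ k * (3 * (1 - x') * x)" by simp
  also have "\<dots> \<le> \<epsilon> * 3 ^ k * ((1 - x) * x')"
    using tri \<epsilon> by (intro mult_left_mono) auto
  also have "\<dots> = (\<epsilon> * 3 ^ k * (1 - x)) * x'" by simp
  also have "\<dots> \<le> x * x'"
    using Suc.IH by (intro mult_right_mono) (auto simp: x_def x'_def B_def graph_measure_def)
  finally have *: "\<epsilon> * 3 ^ Suc k * (1 - x') \<le> x'"
    using xpos by (simp add: mult.commute)
  have "enlargement V B T \<subseteq> enlargement V A (Suc k * T)"
    using enlargement_enlargement [OF V(1) neV A(1), of "k * T" T]
    by (simp add: B_def algebra_simps)
  then have "x' \<le> graph_measure V (enlargement V A (Suc k * T))"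
    unfolding x'_def by (rule graph_measure_mono)
  moreover from this have "\<epsilon> * 3 ^ Suc k * (1 - graph_measure V (enlargement V A (Suc k * T)))
      \<le> \<epsilon> * 3 ^ Suc k * (1 - x')"
    using \<epsilon> by (intro mult_left_mono) auto
  ultimately show ?case using * by linarith
qed

theorem theorem2p2:
  shows "\<exists>C::real. C > 0 \<and>
    (\<forall>(n::nat) (\<epsilon>::real) (V::nat set) (\<G>::nat graph set).
      n \<ge> 2 \<longrightarrow> 0 < \<epsilon> \<longrightarrow> \<epsilon> < 1 \<longrightarrow>
      finite V \<longrightarrow> card V = n \<longrightarrow>
      \<G> \<subseteq> graphs_on V \<longrightarrow> relabel_invariant V \<G> \<longrightarrow>
      graph_measure V \<G> \<ge> \<epsilon> \<longrightarrow>
      graph_measure V (enlargement V \<G> (C * ln (1 / \<epsilon>) * sqrt (real n / ln (real n)))) \<ge> 1 - \<epsilon>)"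
proof (intro exI [of _ 48] conjI allI impI)
  fix n :: nat and \<epsilon> :: real and V :: "nat set" and A :: "nat graph set"
  assume n: "n \<ge> 2" and \<epsilon>: "0 < \<epsilon>" "\<epsilon> < 1" and V: "finite V" "card V = n"
    and A: "A \<subseteq> graphs_on V" "relabel_invariant V A" and mu: "graph_measure V A \<ge> \<epsilon>"
  define s where "s = sqrt (real n / ln (real n))"
  define l where "l = ln (1 / \<epsilon>)"
  have s: "s \<ge> 0" using n by (simp add: s_def)
  have l: "l > 0" using \<epsilon> by (simp add: l_def)
  have neV: "V \<noteq> {}" using V n by auto
  have "1 - \<epsilon> \<le> graph_measure V (enlargement V A (48 * l * s))"
  \<comment> \<open>If \<open>\<epsilon>\<close> is at least one half, the family itself is already large enough.  Otherwise \<open>ln (1 / \<epsilon>)\<close> is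
    bounded below, which absorbs the rounding of the number of steps.\<close>
  proof (cases "\<epsilon> \<ge> 1 / 2")
    case True
    have "graph_measure V A \<le> graph_measure V (enlargement V A (48 * l * s))"
      using s l by (intro graph_measure_mono subset_enlargement V neV A) simp
    with True mu show ?thesis by linarith
  next
    case False
    have "1 / 2 \<le> ln (2 :: real)" using ln2_ge_two_thirds by simp
    also have "\<dots> \<le> l"
      unfolding l_def using False \<epsilon> by (subst ln_le_cancel_iff) (auto simp: field_simps)
    finally have l2: "1 / 2 \<le> l" .
    define k where "k = nat \<lceil>2 * l\<rceil>"
    have k: "2 * l \<le> real k" "real k \<le> 4 * l"
      using l2 by (simp_all add: k_def) linarith+
    \<comment> \<open>Odds of \<open>1 / \<epsilon>\<close> are needed, starting from odds \<open>\<epsilon>\<close>; tripling beats the factor \<open>exp 1\<close>.\<close>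
    have "1 / \<epsilon> ^ 2 = exp (2 * l)"
      using \<epsilon> by (simp add: l_def exp_double power_divide)
    also have "\<dots> \<le> exp (real k)" using k by simp
    also have "\<dots> = exp 1 ^ k" by (simp add: exp_of_nat_mult [symmetric])
    also have "\<dots> \<le> 3 ^ k" using exp_le by (intro power_mono) auto
    finally have pow: "1 \<le> 3 ^ k * \<epsilon>\<^sup>2" using \<epsilon> by (simp add: field_simps)
    define y where "y = 1 - graph_measure V (enlargement V A (k * (12 * s)))"
    have y0: "y \<ge> 0" using graph_measure_le_1 by (simp add: y_def)
    have "\<epsilon> * 3 ^ k * y \<le> 1"
      using iterated_expansion [OF V(1) _ A \<epsilon>(1) mu refl, of k] n graph_measure_le_1
      unfolding y_def s_def V(2) by (meson order_trans)
    then have "\<epsilon> * (\<epsilon> * 3 ^ k * y) \<le> \<epsilon>" using \<epsilon> mult_left_mono [of _ 1 \<epsilon>] by simp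
    moreover have "1 * y \<le> (3 ^ k * \<epsilon>\<^sup>2) * y" using pow y0 by (intro mult_right_mono)
    ultimately have "y \<le> \<epsilon>" by (simp add: power2_eq_square mult_ac)
    moreover have "real k * (12 * s) \<le> 48 * l * s"
      using k(2) s mult_right_mono [of "real k" "4 * l" "12 * s"] by simp
    then have "graph_measure V (enlargement V A (k * (12 * s)))
        \<le> graph_measure V (enlargement V A (48 * l * s))"
      by (intro graph_measure_mono enlargement_mono V A)
    ultimately show ?thesis by (simp add: y_def)
  qed
  then show "graph_measure V (enlargement V A (48 * ln (1 / \<epsilon>) * sqrt (real n / ln (real n)))) \<ge> 1 - \<epsilon>"
    by (simp add: l_def s_def)
qed simp

end
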